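(* Let $\Bbbk$ be a field and let $\mathbb{V}$ be the $\Bbbk$-algebra generated by $y_1,y_2,x_1,x_2$ subject to the relations $$x_2x_1=x_1x_2,\quad y_2y_1=-y_1y_2,\quad y_1x_2=x_2y_1,\quad y_2x_2=x_2y_2,$$ $$y_1x_1=x_2y_1+x_1y_2,\quad y_2x_1=-x_1y_1+x_2y_1.$$ Let $S\subset\Bbbk\{y_1,y_2,x_1,x_2\}$ be the set consisting of the six polynomials $$x_2x_1-x_1x_2,\quad y_2y_1+y_1y_2,\quad x_2y_1-y_1x_2,\quad x_2y_2-y_2x_2,$$ $$x_1y_2+y_1x_2-y_1x_1,\quad x_1y_1+y_2x_1-y_1x_2.$$ Then, with respect to the degree lexicographic order with $y_1\prec y_2\prec x_1\prec x_2$, the set $S$ is a Gröbner-Shirshov basis of the ideal $\mathrm{Id}(S)$, which is the ideal of defining relations of $\mathbb{V}$, i.e. $\mathbb{V}=\Bbbk\{y_1,y_2,x_1,x_2\}/\mathrm{Id}(S)$.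
   Context: Let $X=\{y_1,y_2,x_1,x_2\}$, let $X^*$ be the free monoid of words in $X$, and let $\Bbbk\{X\}$ be the free associative unital $\Bbbk$-algebra on $X$ (noncommutative polynomials). $\mathrm{Id}(S)$ denotes the two-sided ideal of $\Bbbk\{X\}$ generated by $S$. The degree lexicographic order $\prec$ on $X^*$ compares words first by length and then, for equal length, lexicographically from left to right with $y_1\prec y_2\prec x_1\prec x_2$. For a nonzero $f\in\Bbbk\{X\}$, $\overline{f}$ denotes its leading (i.e. $\prec$-largest) word; $f$ is monic if the coefficient of $\overline{f}$ is $1$. For monic $f,g$: (i) if $w=\overline{f}a=b\overline{g}$ with $a,b\in X^*$ and $|\overline{f}|+|\overline{g}|>|w|$, then $(f,g)_w:=fa-bg$ is the intersection composition; (ii) if $w=\overline{f}=a\overline{g}b$ with $a,b\in X^*$, then $(f,g)_w:=f-agb$ is the inclusion composition. A composition $(f,g)_w$ is trivial modulo $S$ if $(f,g)_w=\sum_i\alpha_i a_is_ib_i$ (finite sum) with $\alpha_i\in\Bbbk$, $a_i,b_i\in X^*$, $s_i\in S$ and $a_i\overline{s_i}b_i\prec w$ for all $i$. A nonempty set $S$ of monic polynomials is a Gröbner-Shirshov basis of $\mathrm{Id}(S)$ if every composition $(f,g)_w$ with $f,g\in S$ is trivial modulo $S$. *)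

theory Defs
  imports "HOL-Library.Poly_Mapping" "HOL-Algebra.QuotRing" "HOL-Algebra.Module"
begin

(* Lists under concatenation form the free monoid.  This instance turns the finitely supported
   functions from words to 'k into the monoid algebra, i.e. the free associative unital algebra,
   via the convolution product of HOL-Library.Poly_Mapping. *)
instantiation list :: (type) monoid_add
begin

definition zero_list :: "'a list"
  where "zero_list = []"

definition plus_list :: "'a list \<Rightarrow> 'a list \<Rightarrow> 'a list"
  where "plus_list u v = u @ v"

instance
  by standard (simp_all add: zero_list_def plus_list_def)

end

type_synonym ('x, 'k) ncpoly = "'x list \<Rightarrow>\<^sub>0 'k"

definition word :: "'x list \<Rightarrow> ('x, 'k::field) ncpoly"
  where "word w = Poly_Mapping.single w 1"

abbreviation var :: "'x \<Rightarrow> ('x, 'k::field) ncpoly"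
  where "var x \<equiv> word [x]"

definition scale :: "'k::field \<Rightarrow> ('x, 'k) ncpoly \<Rightarrow> ('x, 'k) ncpoly"
  where "scale c f = Poly_Mapping.map ((*) c) f"

definition free_alg :: "('k::field, ('x, 'k) ncpoly) module"
  where "free_alg =
    \<lparr>carrier = UNIV, mult = (*), one = 1, zero = 0, add = (+), smult = scale\<rparr>"

lemma ring_free_alg: "ring free_alg"
  by (rule ringI)
    (auto simp: free_alg_def algebra_simps intro!: abelian_groupI monoidI exI[of _ "- _"])

(* The factor ring A Quot I with the induced scalar action c (I + f) = I + c f. *)
definition FactAlg :: "('k, 'a, 'b) module_scheme \<Rightarrow> 'a set \<Rightarrow> ('k, 'a set) module"
  where "FactAlg A I =
    \<lparr>carrier = carrier (A Quot I), mult = mult (A Quot I), one = one (A Quot I),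
     zero = zero (A Quot I), add = add (A Quot I),
     smult = (\<lambda>c C. \<Union>f\<in>C. I +>\<^bsub>A\<^esub> (c \<odot>\<^bsub>A\<^esub> f))\<rparr>"

(* A pair (l, r) stands for the relation l = r.  The constant genideal generates two-sided
   ideals, as HOL-Algebra's ideal is closed under multiplication from both sides. *)
definition relation_ideal ::
  "(('x, 'k::field) ncpoly \<times> ('x, 'k) ncpoly) set \<Rightarrow> ('x, 'k) ncpoly set"
  where "relation_ideal R = Idl\<^bsub>free_alg\<^esub> {l - r |l r. (l, r) \<in> R}"

definition presented_alg ::
  "(('x, 'k::field) ncpoly \<times> ('x, 'k) ncpoly) set \<Rightarrow> ('k, ('x, 'k) ncpoly set) module"
  where "presented_alg R = FactAlg free_alg (relation_ideal R)"

abbreviation deglex_less :: "'x::linorder list \<Rightarrow> 'x list \<Rightarrow> bool" (infix \<open>\<prec>\<close> 50)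
  where "u \<prec> v \<equiv> (u, v) \<in> lenlex {(x, y). x < y}"

(* Meaningful for nonzero f only. *)
definition lead :: "('x::linorder, 'k::field) ncpoly \<Rightarrow> 'x list"
  where "lead f =
    (THE w. w \<in> Poly_Mapping.keys f \<and> (\<forall>v\<in>Poly_Mapping.keys f. v \<noteq> w \<longrightarrow> v \<prec> w))"

definition monic :: "('x::linorder, 'k::field) ncpoly \<Rightarrow> bool"
  where "monic f \<longleftrightarrow> f \<noteq> 0 \<and> Poly_Mapping.lookup f (lead f) = 1"

(* composition f g w h: h is a composition (f, g)_w. *)
inductive composition ::
  "('x::linorder, 'k::field) ncpoly \<Rightarrow> ('x, 'k) ncpoly \<Rightarrow> 'x list \<Rightarrow> ('x, 'k) ncpoly \<Rightarrow> bool"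
  for f g
  where
    intersection:
      "\<lbrakk>w = lead f @ a; w = b @ lead g; length (lead f) + length (lead g) > length w\<rbrakk>
        \<Longrightarrow> composition f g w (f * word a - word b * g)"
  | inclusion:
      "\<lbrakk>w = lead f; w = a @ lead g @ b\<rbrakk>
        \<Longrightarrow> composition f g w (f - word a * g * word b)"

definition trivial_mod ::
  "('x::linorder, 'k::field) ncpoly set \<Rightarrow> 'x list \<Rightarrow> ('x, 'k) ncpoly \<Rightarrow> bool"
  where "trivial_mod S w h \<longleftrightarrow>
    (\<exists>(n::nat) \<alpha> a s b.
      (\<forall>i<n. s i \<in> S \<and> a i @ lead (s i) @ b i \<prec> w) \<and>
      h = (\<Sum>i<n. scale (\<alpha> i) (word (a i) * s i * word (b i))))"

definition groebner_shirshov_basis ::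
  "('x::linorder, 'k::field) ncpoly set \<Rightarrow> ('x, 'k) ncpoly set \<Rightarrow> bool"
  where "groebner_shirshov_basis S I \<longleftrightarrow>
    S \<noteq> {} \<and> (\<forall>f\<in>S. monic f) \<and> I = Idl\<^bsub>free_alg\<^esub> S \<and>
    (\<forall>f\<in>S. \<forall>g\<in>S. \<forall>w h. composition f g w h \<longrightarrow> trivial_mod S w h)"

datatype gen = Y1 | Y2 | X1 | X2

fun gen_rank :: "gen \<Rightarrow> nat"
  where
    "gen_rank Y1 = 0"
  | "gen_rank Y2 = 1"
  | "gen_rank X1 = 2"
  | "gen_rank X2 = 3"

instantiation gen :: linorder
begin

definition less_eq_gen :: "gen \<Rightarrow> gen \<Rightarrow> bool"
  where "x \<le> y \<longleftrightarrow> gen_rank x \<le> gen_rank y"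

definition less_gen :: "gen \<Rightarrow> gen \<Rightarrow> bool"
  where "x < y \<longleftrightarrow> gen_rank x < gen_rank y"

instance
proof
  fix x y :: gen
  show "x \<le> y \<Longrightarrow> y \<le> x \<Longrightarrow> x = y"
    by (cases x; cases y) (simp_all add: less_eq_gen_def)
qed (auto simp: less_eq_gen_def less_gen_def)

end

abbreviation y1 :: "(gen, 'k::field) ncpoly" where "y1 \<equiv> var Y1"
abbreviation y2 :: "(gen, 'k::field) ncpoly" where "y2 \<equiv> var Y2"
abbreviation x1 :: "(gen, 'k::field) ncpoly" where "x1 \<equiv> var X1"
abbreviation x2 :: "(gen, 'k::field) ncpoly" where "x2 \<equiv> var X2"

end

theory Submission
  imports Defs
begin

text \<open>
  All six leading words are quadratic, namely
  \<open>x2 x1\<close>, \<open>y2 y1\<close>, \<open>x2 y1\<close>, \<open>x2 y2\<close>, \<open>x1 y2\<close>, \<open>x1 y1\<close>, and they are pairwise distinct.  Two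
  quadratic words overlap properly only in one letter, and an overlap in two letters identifies
  the two polynomials (lemma \<open>composition_quadraticE\<close>).  This leaves the compositions at
  \<open>x2 x1 y2\<close>, \<open>x2 x1 y1\<close>, \<open>x2 y2 y1\<close> and \<open>x1 y2 y1\<close>.  Each is trivial: rewriting its terms by
  replacing leading words with the corresponding lower terms ends in zero, and recording the
  rewriting steps gives an explicit combination with coefficients \<open>1\<close> and \<open>-1\<close>.  Every recorded
  step starts from a word smaller than the overlap.

  The defining relations and the six polynomials generate the same ideal because, up to sign,
  they differ only in that \<open>x2 y1\<close> was replaced by \<open>y1 x2\<close> in the two relations with three terms,
  which is a change by a multiple of \<open>x2 y1 - y1 x2\<close>.
\<close>

section \<open>Words, leading words and trivial compositions\<close>

lemma word_mult: "word u * word v = (word (u @ v) :: ('x, 'k::field) ncpoly)"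
  by (simp add: word_def mult_single plus_list_def)

lemma word_Nil: "word [] = (1 :: ('x, 'k::field) ncpoly)"
  by (simp add: word_def zero_list_def flip: single_one)

lemma keys_word: "Poly_Mapping.keys (word w :: ('x, 'k::field) ncpoly) = {w}"
  by (simp add: word_def)

lemma keys_uminus: "Poly_Mapping.keys (- f) = Poly_Mapping.keys (f :: ('x, 'k::field) ncpoly)"
  by (simp add: set_eq_iff in_keys_iff)

lemma scale_1: "scale 1 f = f"
  by (rule poly_mapping_eqI) (simp add: scale_def Poly_Mapping.map.rep_eq when_def)

lemma scale_minus_1: "scale (- 1) f = - f"
  by (rule poly_mapping_eqI) (simp add: scale_def Poly_Mapping.map.rep_eq when_def)

lemma deglex_less_trans: "u \<prec> v \<Longrightarrow> v \<prec> w \<Longrightarrow> u \<prec> w"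
  by (rule transD[OF lenlex_transI]) (auto intro: transI)

lemma deglex_less_irrefl: "\<not> w \<prec> w"
  by (rule lenlex_irreflexive) simp

lemma lead_and_monic_word_plus:
  fixes r :: "('x::linorder, 'k::field) ncpoly"
  assumes lower: "\<And>v. v \<in> Poly_Mapping.keys r \<Longrightarrow> v \<prec> w"
  shows "lead (word w + r) = w" and "monic (word w + r)"
proof -
  let ?f = "word w + r"
  have notin: "w \<notin> Poly_Mapping.keys r"
    using lower deglex_less_irrefl by blast
  then have coeff: "Poly_Mapping.lookup ?f w = 1"
    by (simp add: lookup_add word_def in_keys_iff)
  then have top: "w \<in> Poly_Mapping.keys ?f"
    by (simp add: in_keys_iff)
  have "Poly_Mapping.keys ?f \<subseteq> insert w (Poly_Mapping.keys r)"
    using Poly_Mapping.keys_add[of "word w" r] by (simp add: keys_word)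
  with lower have below: "\<forall>v\<in>Poly_Mapping.keys ?f. v \<noteq> w \<longrightarrow> v \<prec> w"
    by blast
  show lead: "lead ?f = w"
    unfolding lead_def
  proof (rule the_equality)
    show "w \<in> Poly_Mapping.keys ?f \<and> (\<forall>v\<in>Poly_Mapping.keys ?f. v \<noteq> w \<longrightarrow> v \<prec> w)"
      using top below by (rule conjI)
  next
    fix u
    assume u: "u \<in> Poly_Mapping.keys ?f \<and> (\<forall>v\<in>Poly_Mapping.keys ?f. v \<noteq> u \<longrightarrow> v \<prec> u)"
    show "u = w"
    proof (rule ccontr)
      assume "u \<noteq> w"
      then have "u \<prec> w" and "w \<prec> u"
        using u top below by simp_all
      then show False
        using deglex_less_trans deglex_less_irrefl by metis
    qed
  qed
  show "monic ?f"
    unfolding monic_def lead using coeff by auto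
qed

text \<open>
  Listing the summands as tuples of coefficient, left factor, polynomial and right factor lets a
  triviality certificate be written down without indexing functions.
\<close>

lemma trivial_modI:
  assumes h: "h = (\<Sum>(c, a, s, b)\<leftarrow>ts. scale c (word a * s * word b))"
    and terms: "\<forall>(c, a, s, b) \<in> set ts. s \<in> S \<and> a @ lead s @ b \<prec> w"
  shows "trivial_mod S w h"
  unfolding trivial_mod_def
proof (intro exI conjI allI impI)
  fix i assume "i < length ts"
  then have "ts ! i \<in> set ts" by simp
  with terms show "fst (snd (snd (ts ! i))) \<in> S"
    and "fst (snd (ts ! i)) @ lead (fst (snd (snd (ts ! i)))) @ snd (snd (snd (ts ! i))) \<prec> w"
    by (fastforce simp: case_prod_beta)+
next
  show "h =
    (\<Sum>i<length ts. scale (fst (ts ! i)) (word (fst (snd (ts ! i))) *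
      fst (snd (snd (ts ! i))) * word (snd (snd (snd (ts ! i))))))"
    by (simp add: h sum_list_sum_nth case_prod_beta atLeast0LessThan)
qed

lemma trivial_mod_0: "trivial_mod S w 0"
  by (rule trivial_modI[of _ "[]"]) simp_all

text \<open>
  For quadratic leading words an inclusion, and likewise an intersection of length two, forces
  equal leading words; every other composition lives on a word of length three.
\<close>

lemma composition_quadraticE:
  assumes comp: "composition f g w h" and f: "lead f = [p, q]" and g: "lead g = [r, s]"
  obtains (equal) "p = r" "q = s" "h = f - g"
  | (overlap) "q = r" "w = [p, q, s]" "h = f * word [s] - word [p] * g"
  using comp
proof cases
  case (intersection a b)
  have eq: "p # q # a = b @ [r, s]"
    using intersection f g by simp
  then have "length b < 2"
    using intersection f g by (simp add: arg_cong[OF eq, of length])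
  then consider "b = []" | c where "b = [c]"
    by (cases b) auto
  then show thesis
    using equal overlap eq intersection f by cases (auto simp: word_Nil)
next
  case (inclusion a b)
  have "p # q # [] = a @ r # s # b"
    using inclusion f g by simp
  then have "a = []" "b = []" "p = r" "q = s"
    by (auto simp: append_eq_Cons_conv Cons_eq_append_conv)
  then show thesis
    using equal inclusion by (simp add: word_Nil)
qed

section \<open>Ideals of the free algebra\<close>

lemma genideal_free_alg: "ideal (Idl\<^bsub>free_alg\<^esub> A) (free_alg :: ('k::field, ('x, 'k) ncpoly) module)"
  by (rule ring.genideal_ideal[OF ring_free_alg]) (simp add: free_alg_def)

lemma genideal_free_alg_superset: "f \<in> A \<Longrightarrow> f \<in> Idl\<^bsub>free_alg\<^esub> A"
  using ring.genideal_self[OF ring_free_alg, of A] by (auto simp: free_alg_def)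

lemma genideal_free_alg_subset:
  "A \<subseteq> Idl\<^bsub>free_alg\<^esub> B \<Longrightarrow> Idl\<^bsub>free_alg\<^esub> A \<subseteq> Idl\<^bsub>free_alg\<^esub> B"
  by (rule ring.genideal_minimal[OF ring_free_alg genideal_free_alg])

lemma genideal_free_alg_add:
  "f \<in> Idl\<^bsub>free_alg\<^esub> A \<Longrightarrow> g \<in> Idl\<^bsub>free_alg\<^esub> A \<Longrightarrow> f + g \<in> Idl\<^bsub>free_alg\<^esub> A"
  using additive_subgroup.a_closed[OF ideal.axioms(1)[OF genideal_free_alg]]
  by (simp add: free_alg_def)

lemma genideal_free_alg_uminus:
  assumes "f \<in> Idl\<^bsub>free_alg\<^esub> A"
  shows "- f \<in> Idl\<^bsub>free_alg\<^esub> A"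
  using ideal.I_l_closed[OF genideal_free_alg assms, of "- 1"] by (simp add: free_alg_def)

lemma genideal_free_alg_diff:
  "f \<in> Idl\<^bsub>free_alg\<^esub> A \<Longrightarrow> g \<in> Idl\<^bsub>free_alg\<^esub> A \<Longrightarrow> f - g \<in> Idl\<^bsub>free_alg\<^esub> A"
  using genideal_free_alg_add[of f A "- g"] genideal_free_alg_uminus by auto

section \<open>The six polynomials\<close>

definition s_x2x1 :: "(gen, 'k::field) ncpoly" where "s_x2x1 = x2 * x1 - x1 * x2"
definition s_y2y1 :: "(gen, 'k::field) ncpoly" where "s_y2y1 = y2 * y1 + y1 * y2"
definition s_x2y1 :: "(gen, 'k::field) ncpoly" where "s_x2y1 = x2 * y1 - y1 * x2"
definition s_x2y2 :: "(gen, 'k::field) ncpoly" where "s_x2y2 = x2 * y2 - y2 * x2"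
definition s_x1y2 :: "(gen, 'k::field) ncpoly" where "s_x1y2 = x1 * y2 + y1 * x2 - y1 * x1"
definition s_x1y1 :: "(gen, 'k::field) ncpoly" where "s_x1y1 = x1 * y1 + y2 * x1 - y1 * x2"

lemmas s_defs = s_x2x1_def s_y2y1_def s_x2y1_def s_x2y2_def s_x1y2_def s_x1y1_def

definition basis :: "(gen, 'k::field) ncpoly set"
  where "basis = {s_x2x1, s_y2y1, s_x2y1, s_x2y2, s_x1y2, s_x1y1}"

lemma deglex_gen_2:
  "[a, b] \<prec> [c, d] \<longleftrightarrow> gen_rank a < gen_rank c \<or> a = c \<and> gen_rank b < gen_rank d"
  by (auto simp: lenlex_conv less_gen_def)

lemma deglex_gen_3:
  "[a, b, c] \<prec> [d, e, f] \<longleftrightarrow>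
    gen_rank a < gen_rank d \<or>
    a = d \<and> (gen_rank b < gen_rank e \<or> b = e \<and> gen_rank c < gen_rank f)"
  by (auto simp: lenlex_conv less_gen_def)

lemma lead_and_monic_basis:
  shows "lead (s_x2x1 :: (gen, 'k::field) ncpoly) = [X2, X1]"
      "monic (s_x2x1 :: (gen, 'k::field) ncpoly)"
    and "lead (s_y2y1 :: (gen, 'k::field) ncpoly) = [Y2, Y1]"
      "monic (s_y2y1 :: (gen, 'k::field) ncpoly)"
    and "lead (s_x2y1 :: (gen, 'k::field) ncpoly) = [X2, Y1]"
      "monic (s_x2y1 :: (gen, 'k::field) ncpoly)"
    and "lead (s_x2y2 :: (gen, 'k::field) ncpoly) = [X2, Y2]"
      "monic (s_x2y2 :: (gen, 'k::field) ncpoly)"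
    and "lead (s_x1y2 :: (gen, 'k::field) ncpoly) = [X1, Y2]"
      "monic (s_x1y2 :: (gen, 'k::field) ncpoly)"
    and "lead (s_x1y1 :: (gen, 'k::field) ncpoly) = [X1, Y1]"
      "monic (s_x1y1 :: (gen, 'k::field) ncpoly)"
proof -
  have keys: "v \<in> Poly_Mapping.keys (word u + r) \<Longrightarrow> v = u \<or> v \<in> Poly_Mapping.keys r"
    "v \<in> Poly_Mapping.keys (word u - r) \<Longrightarrow> v = u \<or> v \<in> Poly_Mapping.keys r"
    for u v and r :: "(gen, 'k) ncpoly"
    using Poly_Mapping.keys_add[of "word u" r] Poly_Mapping.keys_diff[of "word u" r]
    by (auto simp: keys_word)
  note lem = lead_and_monic_word_plus[where 'x = gen and 'k = 'k]
  note lm = deglex_gen_2 keys_word keys_uminus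
  have 1: "(s_x2x1 :: (gen, 'k) ncpoly) = word [X2, X1] + - word [X1, X2]"
    and 2: "(s_y2y1 :: (gen, 'k) ncpoly) = word [Y2, Y1] + word [Y1, Y2]"
    and 3: "(s_x2y1 :: (gen, 'k) ncpoly) = word [X2, Y1] + - word [Y1, X2]"
    and 4: "(s_x2y2 :: (gen, 'k) ncpoly) = word [X2, Y2] + - word [Y2, X2]"
    and 5: "(s_x1y2 :: (gen, 'k) ncpoly) = word [X1, Y2] + (word [Y1, X2] - word [Y1, X1])"
    and 6: "(s_x1y1 :: (gen, 'k) ncpoly) = word [X1, Y1] + (word [Y2, X1] - word [Y1, X2])"
    by (simp_all add: s_defs word_mult)
  show "lead (s_x2x1 :: (gen, 'k) ncpoly) = [X2, X1]" "monic (s_x2x1 :: (gen, 'k) ncpoly)"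
    unfolding 1 by - (rule lem; auto simp: lm dest!: keys)+
  show "lead (s_y2y1 :: (gen, 'k) ncpoly) = [Y2, Y1]" "monic (s_y2y1 :: (gen, 'k) ncpoly)"
    unfolding 2 by - (rule lem; auto simp: lm dest!: keys)+
  show "lead (s_x2y1 :: (gen, 'k) ncpoly) = [X2, Y1]" "monic (s_x2y1 :: (gen, 'k) ncpoly)"
    unfolding 3 by - (rule lem; auto simp: lm dest!: keys)+
  show "lead (s_x2y2 :: (gen, 'k) ncpoly) = [X2, Y2]" "monic (s_x2y2 :: (gen, 'k) ncpoly)"
    unfolding 4 by - (rule lem; auto simp: lm dest!: keys)+
  show "lead (s_x1y2 :: (gen, 'k) ncpoly) = [X1, Y2]" "monic (s_x1y2 :: (gen, 'k) ncpoly)"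
    unfolding 5 by - (rule lem; auto simp: lm dest!: keys)+
  show "lead (s_x1y1 :: (gen, 'k) ncpoly) = [X1, Y1]" "monic (s_x1y1 :: (gen, 'k) ncpoly)"
    unfolding 6 by - (rule lem; auto simp: lm dest!: keys)+
qed

section \<open>The four overlaps\<close>

text \<open>
  Each list below records a reduction of the composition to zero.  An entry is one rewriting step:
  its sign is that of the term being rewritten, and its leading word in context is that term.
\<close>

lemma trivial_x2_x1_y2:
  "trivial_mod basis [X2, X1, Y2] (s_x2x1 * y2 - x2 * s_x1y2 :: (gen, 'k::field) ncpoly)"
  by (rule trivial_modI[where ts =
      "[(- 1, [X1], s_x2y2, []), (- 1, [], s_x1y2, [X2]), (- 1, [], s_x2y1, [X2]),
       (1, [], s_x2y1, [X1]), (1, [Y1], s_x2x1, [])]"])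
    (simp add: scale_1 scale_minus_1 s_defs word_mult algebra_simps,
     simp add: basis_def lead_and_monic_basis deglex_gen_3)

lemma trivial_x2_x1_y1:
  "trivial_mod basis [X2, X1, Y1] (s_x2x1 * y1 - x2 * s_x1y1 :: (gen, 'k::field) ncpoly)"
  by (rule trivial_modI[where ts =
      "[(- 1, [X1], s_x2y1, []), (- 1, [], s_x1y1, [X2]), (- 1, [], s_x2y2, [X1]),
       (- 1, [Y2], s_x2x1, []), (1, [], s_x2y1, [X2])]"])
    (simp add: scale_1 scale_minus_1 s_defs word_mult algebra_simps,
     simp add: basis_def lead_and_monic_basis deglex_gen_3)

lemma trivial_x2_y2_y1:
  "trivial_mod basis [X2, Y2, Y1] (s_x2y2 * y1 - x2 * s_y2y1 :: (gen, 'k::field) ncpoly)"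
  by (rule trivial_modI[where ts =
      "[(- 1, [Y2], s_x2y1, []), (- 1, [], s_y2y1, [X2]), (- 1, [], s_x2y1, [Y2]),
       (- 1, [Y1], s_x2y2, [])]"])
    (simp add: scale_1 scale_minus_1 s_defs word_mult algebra_simps,
     simp add: basis_def lead_and_monic_basis deglex_gen_3)

lemma trivial_x1_y2_y1:
  "trivial_mod basis [X1, Y2, Y1] (s_x1y2 * y1 - x1 * s_y2y1 :: (gen, 'k::field) ncpoly)"
  by (rule trivial_modI[where ts =
      "[(1, [Y1], s_x2y1, []), (- 1, [Y1], s_x1y1, []), (- 1, [], s_x1y1, [Y2]),
       (1, [Y2], s_x1y2, []), (- 1, [], s_y2y1, [X2]), (1, [], s_y2y1, [X1]),
       (- 1, [Y1], s_x2y2, [])]"])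
    (simp add: scale_1 scale_minus_1 s_defs word_mult algebra_simps,
     simp add: basis_def lead_and_monic_basis deglex_gen_3)

text \<open>
  No leading word begins with \<open>y1\<close> or ends in \<open>x2\<close>, so the middle letter of an overlap is
  \<open>x1\<close> or \<open>y2\<close>.
\<close>

lemma groebner_shirshov_basis_basis:
  "groebner_shirshov_basis basis (Idl\<^bsub>free_alg\<^esub> (basis :: (gen, 'k::field) ncpoly set))"
  unfolding groebner_shirshov_basis_def
proof (intro conjI ballI allI impI refl)
  show "(basis :: (gen, 'k) ncpoly set) \<noteq> {}"
    by (simp add: basis_def)
  show "monic f" if "f \<in> basis" for f :: "(gen, 'k) ncpoly"
    using that by (auto simp: basis_def lead_and_monic_basis)
  fix f g h :: "(gen, 'k) ncpoly" and w
  assume f: "f \<in> basis" and g: "g \<in> basis" and comp: "composition f g w h"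
  obtain p q r s where lead: "lead f = [p, q]" "lead g = [r, s]"
    using f g by (auto simp: basis_def lead_and_monic_basis)
  from comp lead show "trivial_mod basis w h"
  proof (cases rule: composition_quadraticE)
    case equal
    then have "f = g"
      using f g lead by (auto simp: basis_def lead_and_monic_basis)
    with equal show ?thesis
      by (simp add: trivial_mod_0)
  next
    case overlap
    then show ?thesis
      using f g lead trivial_x2_x1_y2 trivial_x2_x1_y1 trivial_x2_y2_y1 trivial_x1_y2_y1
      by (auto simp: basis_def lead_and_monic_basis)
  qed
qed

section \<open>The ideal of defining relations\<close>

lemma genideal_basis_eq_relation_ideal:
  "Idl\<^bsub>free_alg\<^esub> basis = relation_ideal
    {(x2 * x1, x1 * x2),
     (y2 * y1, - (y1 * y2)),
     (y1 * x2, x2 * y1),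
     (y2 * x2, x2 * y2),
     (y1 * x1, x2 * y1 + x1 * y2),
     (y2 * x1, - (x1 * y1) + x2 * y1 :: (gen, 'k::field) ncpoly)}"
  (is "_ = relation_ideal ?R")
proof -
  define D where "D = {l - r |l r. (l, r) \<in> ?R}"
  have D: "D = {s_x2x1, s_y2y1, - s_x2y1, - s_x2y2, - s_x1y2 - s_x2y1, s_x1y1 - s_x2y1}"
  proof -
    have "{l - r |l r. (l, r) \<in> T} = (\<lambda>(l, r). l - r) ` T"
      for T :: "((gen, 'k) ncpoly \<times> (gen, 'k) ncpoly) set"
      by force
    then have "D = (\<lambda>(l, r). l - r) ` ?R"
      by (simp only: D_def)
    moreover have "x2 * x1 - x1 * x2 = (s_x2x1 :: (gen, 'k) ncpoly)"
      "y2 * y1 - - (y1 * y2) = (s_y2y1 :: (gen, 'k) ncpoly)"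
      "y1 * x2 - x2 * y1 = (- s_x2y1 :: (gen, 'k) ncpoly)"
      "y2 * x2 - x2 * y2 = (- s_x2y2 :: (gen, 'k) ncpoly)"
      "y1 * x1 - (x2 * y1 + x1 * y2) = (- s_x1y2 - s_x2y1 :: (gen, 'k) ncpoly)"
      "y2 * x1 - (- (x1 * y1) + x2 * y1) = (s_x1y1 - s_x2y1 :: (gen, 'k) ncpoly)"
      by (simp_all add: s_defs)
    ultimately show ?thesis
      by (simp only: image_insert image_empty prod.case)
  qed
  have "D \<subseteq> Idl\<^bsub>free_alg\<^esub> basis"
  proof -
    have in_basis: "f \<in> basis \<Longrightarrow> f \<in> Idl\<^bsub>free_alg\<^esub> basis" for f :: "(gen, 'k) ncpoly"
      by (rule genideal_free_alg_superset)
    show ?thesis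
      unfolding D using in_basis[of s_x2x1] in_basis[of s_y2y1] in_basis[of s_x2y1]
        in_basis[of s_x2y2] in_basis[of s_x1y2] in_basis[of s_x1y1]
      by (simp add: basis_def genideal_free_alg_diff genideal_free_alg_uminus)
  qed
  moreover have "basis \<subseteq> Idl\<^bsub>free_alg\<^esub> D"
  proof -
    have in_D: "f \<in> D \<Longrightarrow> f \<in> Idl\<^bsub>free_alg\<^esub> D" for f
      by (rule genideal_free_alg_superset)
    have x2y1: "s_x2y1 \<in> Idl\<^bsub>free_alg\<^esub> D"
      using genideal_free_alg_uminus[OF in_D[of "- s_x2y1"]] by (simp add: D)
    have x2y2: "s_x2y2 \<in> Idl\<^bsub>free_alg\<^esub> D"
      using genideal_free_alg_uminus[OF in_D[of "- s_x2y2"]] by (simp add: D)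
    have x1y2: "s_x1y2 \<in> Idl\<^bsub>free_alg\<^esub> D"
      using genideal_free_alg_diff[OF genideal_free_alg_uminus[OF
          in_D[of "- s_x1y2 - s_x2y1"]] x2y1]
      by (simp add: D)
    have x1y1: "s_x1y1 \<in> Idl\<^bsub>free_alg\<^esub> D"
      using genideal_free_alg_add[OF in_D[of "s_x1y1 - s_x2y1"] x2y1]
      by (simp add: D)
    show ?thesis
      using x2y1 x2y2 x1y2 x1y1 in_D[of s_x2x1] in_D[of s_y2y1] by (simp add: basis_def D)
  qed
  ultimately show ?thesis
    unfolding relation_ideal_def D_def[symmetric]
    by (intro equalityI genideal_free_alg_subset)
qed

theorem mainTheorem10:
  fixes R :: "((gen, 'k::field) ncpoly \<times> (gen, 'k) ncpoly) set"
    and V :: "('k, (gen, 'k) ncpoly set) module"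
    and S :: "(gen, 'k) ncpoly set"
  assumes R_def: "R =
      {(x2 * x1, x1 * x2),
       (y2 * y1, - (y1 * y2)),
       (y1 * x2, x2 * y1),
       (y2 * x2, x2 * y2),
       (y1 * x1, x2 * y1 + x1 * y2),
       (y2 * x1, - (x1 * y1) + x2 * y1)}"
    and V_def: "V = presented_alg R"
    and S_def: "S =
      {x2 * x1 - x1 * x2,
       y2 * y1 + y1 * y2,
       x2 * y1 - y1 * x2,
       x2 * y2 - y2 * x2,
       x1 * y2 + y1 * x2 - y1 * x1,
       x1 * y1 + y2 * x1 - y1 * x2}"
  shows "groebner_shirshov_basis S (Idl\<^bsub>free_alg\<^esub> S)
    \<and> Idl\<^bsub>free_alg\<^esub> S = relation_ideal R
    \<and> V = FactAlg free_alg (Idl\<^bsub>free_alg\<^esub> S)"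
proof -
  have "S = basis"
    by (simp add: S_def basis_def s_defs)
  then show ?thesis
    unfolding V_def presented_alg_def R_def genideal_basis_eq_relation_ideal[symmetric]
    using groebner_shirshov_basis_basis by simp
qed

end
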